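(* Let $A$ be a ring, $(A,A,I,J,f,g)$ a strict Morita context, and $(R,i,\chi)$ an $A$-ring with a right grouplike character such that $R$ is an $I$-Frobenius $A$-ring, with Frobenius system $(e=e^1\otimes u^1\otimes e^2,\bar\nu)$. The following assertions are equivalent. (1) $A$ is projective as a right $R$-module; (2) there exists $v\in J$ such that $\mathrm{tr}(v)=1_B$.
   Context: All rings are associative with unit. $A$-rings with a right grouplike character: an $A$-ring is a ring $R$ with a ring morphism $i:A\to R$; $R$ is an $A$-bimodule via $arb=i(a)\,r\,i(b)$. A right grouplike character on $R$ is a right $A$-linear map $\chi:R\to A$ with $\chi(\chi(r)s)=\chi(rs)$ for all $r,s\in R$ and $\chi(1_R)=1_A$ (elements of $A$ act on $R$ via $i$). Then $A$ is a right $R$-module via $a\leftharpoonup r=\chi(ar)$, and $B=A^R=\{b\in A\mid b\chi(r)=\chi(br)\text{ for all }r\in R\}$ is a subring of $A$ (so $1_B=1_A$). Strict Morita context $(A,A,I,J,f,g)$: $I,J$ are $A$-bimodules and $f:I\otimes_AJ\to A$, $g:J\otimes_AI\to A$ are $A$-bimodule isomorphisms with $f(u\otimes v)u'=u\,g(v\otimes u')$ and $g(v\otimes u)v'=v f(u\otimes v')$ for all $u,u'\in I$, $v,v'\in J$. $I$-Frobenius: the $A$-ring $R$ is $I$-Frobenius with Frobenius system $(e,\bar\nu)$ if $e=e^1\otimes u^1\otimes e^2\in R\otimes_AI\otimes_AR$ (summation understood) and $\bar\nu:R\otimes_AI\to A$ is an $A$-bimodule map such that for all $r\in R$, $u\in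 I$: $re^1\otimes u^1\otimes e^2=e^1\otimes u^1\otimes e^2r$; $\bar\nu(e^1\otimes_Au^1)e^2=1_R$; $e^1\otimes_Au^1\bar\nu(e^2\otimes_Au)=1_R\otimes_Au$. Trace map: $\mathrm{tr}:J\to B$, $\mathrm{tr}(v)=\chi\bigl(g(v\otimes_A\chi(e^1)u^1)e^2\bigr)$. *)

theory Defs
  imports Complex_Main "HOL-Library.Poly_Mapping"
begin

text \<open>
  Rings are types of sort \<open>{ring, monoid_mult}\<close>: associative with unit, and (unlike \<open>ring_1\<close>)
  with the zero ring allowed. Modules are types of class \<open>ab_group_add\<close> together with explicit
  actions.
\<close>

section \<open>Modules and bimodules\<close>

locale right_module =
  fixes act :: "'m::ab_group_add \<Rightarrow> 'r::{ring, monoid_mult} \<Rightarrow> 'm"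
  assumes act_add_left: "act (x + y) r = act x r + act y r"
    and act_add_right: "act x (r + s) = act x r + act x s"
    and act_mult: "act x (r * s) = act (act x r) s"
    and act_one: "act x 1 = x"

locale left_module =
  fixes act :: "'r::{ring, monoid_mult} \<Rightarrow> 'm::ab_group_add \<Rightarrow> 'm"
  assumes act_add_right: "act r (x + y) = act r x + act r y"
    and act_add_left: "act (r + s) x = act r x + act s x"
    and act_mult: "act (r * s) x = act r (act s x)"
    and act_one: "act 1 x = x"

definition bimodule ::
    "('a::{ring, monoid_mult} \<Rightarrow> 'm::ab_group_add \<Rightarrow> 'm) \<Rightarrow> ('m \<Rightarrow> 'a \<Rightarrow> 'm) \<Rightarrow> bool" where
  "bimodule l r \<longleftrightarrow> left_module l \<and> right_module r \<and> (\<forall>a x b. r (l a x) b = l a (r x b))"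

definition right_linear ::
    "('m::ab_group_add \<Rightarrow> 'r \<Rightarrow> 'm) \<Rightarrow> ('n::ab_group_add \<Rightarrow> 'r \<Rightarrow> 'n) \<Rightarrow> ('m \<Rightarrow> 'n) \<Rightarrow> bool" where
  "right_linear actM actN h \<longleftrightarrow> additive h \<and> (\<forall>x r. h (actM x r) = actN (h x) r)"


section \<open>Projective modules\<close>

text \<open>
  Lifting against all epimorphisms between right modules whose underlying groups are the types
  \<open>'m\<close> and \<open>'n\<close>.
\<close>

definition lifting_property ::
    "'m::ab_group_add itself \<Rightarrow> 'n::ab_group_add itself \<Rightarrow>
     ('p::ab_group_add \<Rightarrow> 'r::{ring, monoid_mult} \<Rightarrow> 'p) \<Rightarrow> bool" where
  "lifting_property _ _ actP \<longleftrightarrow>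
     (\<forall>(actM :: 'm \<Rightarrow> 'r \<Rightarrow> 'm) (actN :: 'n \<Rightarrow> 'r \<Rightarrow> 'n) q h.
        right_module actM \<and> right_module actN \<and>
        right_linear actM actN q \<and> surj q \<and> right_linear actP actN h \<longrightarrow>
        (\<exists>h'. right_linear actP actM h' \<and> (\<forall>x. q (h' x) = h x)))"

text \<open>
  HOL cannot quantify over the types \<open>'m\<close> and \<open>'n\<close> inside a definition, so they are instantiated
  by types large enough to carry the canonical epimorphism from the free right module on \<open>P\<close> onto
  \<open>P\<close>. Lemma \<open>right_projective_lifting\<close> below shows that lifting over all other types follows, so
  nothing is lost.
\<close>

definition right_projective ::
    "('p::ab_group_add \<Rightarrow> 'r::{ring, monoid_mult} \<Rightarrow> 'p) \<Rightarrow> bool" where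
  "right_projective actP \<longleftrightarrow>
     right_module actP \<and> lifting_property TYPE('p \<Rightarrow>\<^sub>0 'r) TYPE('p) actP"

definition lincomb ::
    "('m::ab_group_add \<Rightarrow> 'r::{ring, monoid_mult} \<Rightarrow> 'm) \<Rightarrow> ('x \<Rightarrow> 'm) \<Rightarrow> ('x \<Rightarrow>\<^sub>0 'r) \<Rightarrow> 'm" where
  "lincomb act t \<phi> = (\<Sum>x\<in>Poly_Mapping.keys \<phi>. act (t x) (Poly_Mapping.lookup \<phi> x))"

definition free_act :: "('x \<Rightarrow>\<^sub>0 'r::{ring, monoid_mult}) \<Rightarrow> 'r \<Rightarrow> ('x \<Rightarrow>\<^sub>0 'r)" where
  "free_act \<phi> r = Poly_Mapping.map (\<lambda>c. c * r) \<phi>"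

lemma lookup_free_act: "Poly_Mapping.lookup (free_act \<phi> r) x = Poly_Mapping.lookup \<phi> x * r"
  by (simp add: free_act_def Poly_Mapping.map.rep_eq when_def)

lemma right_module_free_act: "right_module free_act"
  by unfold_locales
    (rule poly_mapping_eqI, simp add: lookup_free_act lookup_add algebra_simps)+

context right_module
begin

lemma act_zero_right: "act x 0 = 0"
  using act_add_right[of x 0 0] by simp

lemma act_zero_left: "act 0 r = 0"
  using act_add_left[of 0 0 r] by simp

lemma act_sum_left: "act (\<Sum>x\<in>S. f x) r = (\<Sum>x\<in>S. act (f x) r)"
  by (induction S rule: infinite_finite_induct) (simp_all add: act_zero_left act_add_left)

lemma lincomb_eq:
  assumes "finite S" "Poly_Mapping.keys \<phi> \<subseteq> S"
  shows "lincomb act t \<phi> = (\<Sum>x\<in>S. act (t x) (Poly_Mapping.lookup \<phi> x))"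
  unfolding lincomb_def
  using assms by (intro sum.mono_neutral_left) (auto simp: in_keys_iff act_zero_right)

lemma right_linear_lincomb:
  fixes t :: "'x \<Rightarrow> 'm"
  shows "right_linear free_act act (lincomb act t)"
  unfolding right_linear_def
proof (intro conjI allI)
  show "additive (lincomb act t)"
  proof
    fix \<phi> \<psi> :: "'x \<Rightarrow>\<^sub>0 'r"
    let ?S = "Poly_Mapping.keys \<phi> \<union> Poly_Mapping.keys \<psi>"
    have S: "finite ?S" "Poly_Mapping.keys (\<phi> + \<psi>) \<subseteq> ?S" "Poly_Mapping.keys \<phi> \<subseteq> ?S" "Poly_Mapping.keys \<psi> \<subseteq> ?S"
      using keys_add[of \<phi> \<psi>] by auto
    show "lincomb act t (\<phi> + \<psi>) = lincomb act t \<phi> + lincomb act t \<psi>"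
      using S by (simp add: lincomb_eq[where S = ?S] lookup_add act_add_right sum.distrib)
  qed
next
  fix \<phi> :: "'x \<Rightarrow>\<^sub>0 'r" and r
  have "Poly_Mapping.keys (free_act \<phi> r) \<subseteq> Poly_Mapping.keys \<phi>"
    by (auto simp: in_keys_iff lookup_free_act)
  then show "lincomb act t (free_act \<phi> r) = act (lincomb act t \<phi>) r"
    by (simp add: lincomb_eq[where S = "Poly_Mapping.keys \<phi>"] lookup_free_act act_mult act_sum_left)
qed

lemma lincomb_single: "lincomb act t (Poly_Mapping.single x 1) = t x"
proof -
  have "lincomb act t (Poly_Mapping.single x 1) =
      (\<Sum>y\<in>{x}. act (t y) (Poly_Mapping.lookup (Poly_Mapping.single x 1) y))"
    by (rule lincomb_eq) auto
  then show ?thesis by (simp add: act_one)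
qed

end

lemma additive_sum_set: "additive h \<Longrightarrow> h (sum f S) = (\<Sum>x\<in>S. h (f x))"
  by (rule additive.sum)

lemma right_projective_lifting:
  fixes actP :: "'p::ab_group_add \<Rightarrow> 'r::{ring, monoid_mult} \<Rightarrow> 'p"
  assumes "right_projective actP"
  shows "lifting_property TYPE('m::ab_group_add) TYPE('n::ab_group_add) actP"
  unfolding lifting_property_def
proof (intro allI impI, elim conjE)
  fix actM :: "'m \<Rightarrow> 'r \<Rightarrow> 'm" and actN :: "'n \<Rightarrow> 'r \<Rightarrow> 'n" and q h
  assume M: "right_module actM" and N: "right_module actN"
    and q: "right_linear actM actN q" and surj: "surj q" and h: "right_linear actP actN h"
  have P: "right_module actP"
    and L: "lifting_property TYPE('p \<Rightarrow>\<^sub>0 'r) TYPE('p) actP"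
    using assms by (auto simp: right_projective_def)
  let ?\<pi> = "lincomb actP (\<lambda>x. x)"
  have "surj ?\<pi>"
    by (rule surjI[where f = "\<lambda>x. Poly_Mapping.single x 1"])
      (simp add: right_module.lincomb_single[OF P])
  moreover have "right_linear free_act actP ?\<pi>"
    by (rule right_module.right_linear_lincomb[OF P])
  moreover have "right_linear actP actP (\<lambda>x. x)"
    by (simp add: right_linear_def additive_def)
  ultimately obtain s where s: "right_linear actP free_act s" "\<And>x. ?\<pi> (s x) = x"
    using L P right_module_free_act unfolding lifting_property_def by blast
  define t where "t x = inv q (h x)" for x
  have t: "q (t x) = h x" for x
    using surj by (simp add: t_def surj_f_inv_f)
  define h' where "h' x = lincomb actM t (s x)" for x
  have lin: "right_linear free_act actM (lincomb actM t)"
    by (rule right_module.right_linear_lincomb[OF M])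
  have "right_linear actP actM h'"
    using s(1) lin by (auto simp: right_linear_def h'_def additive_def)
  moreover have "q (h' x) = h x" for x
  proof -
    have "q (h' x) = (\<Sum>y\<in>Poly_Mapping.keys (s x). actN (h y) (Poly_Mapping.lookup (s x) y))"
      using q by (simp add: h'_def lincomb_def right_linear_def additive_sum_set t)
    also have "\<dots> = h (?\<pi> (s x))"
      using h by (simp add: lincomb_def right_linear_def additive_sum_set)
    finally show ?thesis by (simp add: s(2))
  qed
  ultimately show "\<exists>h'. right_linear actP actM h' \<and> (\<forall>x. q (h' x) = h x)"
    by blast
qed


section \<open>Tensor products over a noncommutative ring\<close>

text \<open>
  \<open>M \<otimes>\<^sub>A N\<close> is the quotient of the free abelian group \<open>('m \<times> 'n) \<Rightarrow>\<^sub>0 int\<close> by the subgroup of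
  relations generated by biadditivity and \<open>A\<close>-balancedness; its elements are cosets.
  The arguments are the right action on \<open>M\<close> and the left action on \<open>N\<close>.
\<close>

inductive_set tensor_rel ::
    "('m::ab_group_add \<Rightarrow> 'a \<Rightarrow> 'm) \<Rightarrow> ('a \<Rightarrow> 'n::ab_group_add \<Rightarrow> 'n) \<Rightarrow> ('m \<times> 'n \<Rightarrow>\<^sub>0 int) set"
  for rM lN where
  zero: "0 \<in> tensor_rel rM lN"
| diff: "x \<in> tensor_rel rM lN \<Longrightarrow> y \<in> tensor_rel rM lN \<Longrightarrow> x - y \<in> tensor_rel rM lN"
| add_left: "frag_of (m + m', n) - (frag_of (m, n) + frag_of (m', n)) \<in> tensor_rel rM lN"
| add_right: "frag_of (m, n + n') - (frag_of (m, n) + frag_of (m, n')) \<in> tensor_rel rM lN"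
| balanced: "frag_of (rM m a, n) - frag_of (m, lN a n) \<in> tensor_rel rM lN"

definition coset_by :: "'g::ab_group_add set \<Rightarrow> 'g \<Rightarrow> 'g set" where
  "coset_by K x = {x + k | k. k \<in> K}"

definition tensor_product ::
    "('m::ab_group_add \<Rightarrow> 'a \<Rightarrow> 'm) \<Rightarrow> ('a \<Rightarrow> 'n::ab_group_add \<Rightarrow> 'n) \<Rightarrow> ('m \<times> 'n \<Rightarrow>\<^sub>0 int) set set" where
  "tensor_product rM lN = range (coset_by (tensor_rel rM lN))"

text \<open>The list \<open>[(m\<^sub>1, n\<^sub>1), \<dots>]\<close> stands for the tensor \<open>m\<^sub>1 \<otimes> n\<^sub>1 + \<dots>\<close>.\<close>

definition tensor_sum ::
    "('m::ab_group_add \<Rightarrow> 'a \<Rightarrow> 'm) \<Rightarrow> ('a \<Rightarrow> 'n::ab_group_add \<Rightarrow> 'n) \<Rightarrow>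
     ('m \<times> 'n) list \<Rightarrow> ('m \<times> 'n \<Rightarrow>\<^sub>0 int) set" where
  "tensor_sum rM lN ps = coset_by (tensor_rel rM lN) (\<Sum>p\<leftarrow>ps. frag_of p)"

definition tensor ::
    "('m::ab_group_add \<Rightarrow> 'a \<Rightarrow> 'm) \<Rightarrow> ('a \<Rightarrow> 'n::ab_group_add \<Rightarrow> 'n) \<Rightarrow>
     'm \<Rightarrow> 'n \<Rightarrow> ('m \<times> 'n \<Rightarrow>\<^sub>0 int) set" where
  "tensor rM lN m n = coset_by (tensor_rel rM lN) (frag_of (m, n))"

definition tensor_add :: "'g::ab_group_add set \<Rightarrow> 'g set \<Rightarrow> 'g set" where
  "tensor_add X Y = {x + y | x y. x \<in> X \<and> y \<in> Y}"

text \<open>The map on \<open>M \<otimes>\<^sub>A N\<close> induced by a map \<open>\<phi>\<close> on pairs, such as an outer action.\<close>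

definition tensor_induced ::
    "('m::ab_group_add \<Rightarrow> 'a \<Rightarrow> 'm) \<Rightarrow> ('a \<Rightarrow> 'n::ab_group_add \<Rightarrow> 'n) \<Rightarrow>
     ('m \<times> 'n \<Rightarrow> 'm \<times> 'n) \<Rightarrow> ('m \<times> 'n \<Rightarrow>\<^sub>0 int) set \<Rightarrow> ('m \<times> 'n \<Rightarrow>\<^sub>0 int) set" where
  "tensor_induced rM lN \<phi> X =
     {frag_extend (frag_of \<circ> \<phi>) x + k | x k. x \<in> X \<and> k \<in> tensor_rel rM lN}"

text \<open>
  \<open>A\<close>-bimodule maps \<open>f : M \<otimes>\<^sub>A N \<rightarrow> A\<close> for \<open>A\<close>-bimodules \<open>M\<close> and \<open>N\<close>; values of \<open>f\<close> on sets that are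
  not cosets play no role.
\<close>

definition tensor_bimodule_map ::
    "('a \<Rightarrow> 'm::ab_group_add \<Rightarrow> 'm) \<Rightarrow> ('m \<Rightarrow> 'a \<Rightarrow> 'm) \<Rightarrow>
     ('a \<Rightarrow> 'n::ab_group_add \<Rightarrow> 'n) \<Rightarrow> ('n \<Rightarrow> 'a \<Rightarrow> 'n) \<Rightarrow>
     (('m \<times> 'n \<Rightarrow>\<^sub>0 int) set \<Rightarrow> 'a::{ring, monoid_mult}) \<Rightarrow> bool" where
  "tensor_bimodule_map lM rM lN rN f \<longleftrightarrow>
     (\<forall>X\<in>tensor_product rM lN. \<forall>Y\<in>tensor_product rM lN. f (tensor_add X Y) = f X + f Y) \<and>
     (\<forall>a. \<forall>X\<in>tensor_product rM lN.
        f (tensor_induced rM lN (\<lambda>(m, n). (lM a m, n)) X) = a * f X) \<and>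
     (\<forall>b. \<forall>X\<in>tensor_product rM lN.
        f (tensor_induced rM lN (\<lambda>(m, n). (m, rN n b)) X) = f X * b)"

text \<open>
  The threefold tensor product \<open>M \<otimes>\<^sub>A N \<otimes>\<^sub>A P\<close>, without choice of a bracketing: the free abelian
  group on triples modulo triadditivity and balancedness in both places.
\<close>

inductive_set tensor3_rel ::
    "('m::ab_group_add \<Rightarrow> 'a \<Rightarrow> 'm) \<Rightarrow> ('a \<Rightarrow> 'n::ab_group_add \<Rightarrow> 'n) \<Rightarrow> ('n \<Rightarrow> 'a \<Rightarrow> 'n) \<Rightarrow>
     ('a \<Rightarrow> 'p::ab_group_add \<Rightarrow> 'p) \<Rightarrow> ('m \<times> 'n \<times> 'p \<Rightarrow>\<^sub>0 int) set"
  for rM lN rN lP where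
  zero: "0 \<in> tensor3_rel rM lN rN lP"
| diff: "x \<in> tensor3_rel rM lN rN lP \<Longrightarrow> y \<in> tensor3_rel rM lN rN lP \<Longrightarrow>
    x - y \<in> tensor3_rel rM lN rN lP"
| add_left: "frag_of (m + m', n, p) - (frag_of (m, n, p) + frag_of (m', n, p))
    \<in> tensor3_rel rM lN rN lP"
| add_mid: "frag_of (m, n + n', p) - (frag_of (m, n, p) + frag_of (m, n', p))
    \<in> tensor3_rel rM lN rN lP"
| add_right: "frag_of (m, n, p + p') - (frag_of (m, n, p) + frag_of (m, n, p'))
    \<in> tensor3_rel rM lN rN lP"
| balanced_left: "frag_of (rM m a, n, p) - frag_of (m, lN a n, p) \<in> tensor3_rel rM lN rN lP"
| balanced_right: "frag_of (m, rN n a, p) - frag_of (m, n, lP a p) \<in> tensor3_rel rM lN rN lP"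

definition tensor3_sum ::
    "('m::ab_group_add \<Rightarrow> 'a \<Rightarrow> 'm) \<Rightarrow> ('a \<Rightarrow> 'n::ab_group_add \<Rightarrow> 'n) \<Rightarrow> ('n \<Rightarrow> 'a \<Rightarrow> 'n) \<Rightarrow>
     ('a \<Rightarrow> 'p::ab_group_add \<Rightarrow> 'p) \<Rightarrow> ('m \<times> 'n \<times> 'p) list \<Rightarrow> ('m \<times> 'n \<times> 'p \<Rightarrow>\<^sub>0 int) set" where
  "tensor3_sum rM lN rN lP ts = coset_by (tensor3_rel rM lN rN lP) (\<Sum>t\<leftarrow>ts. frag_of t)"


section \<open>Rings over a base ring with a right grouplike character\<close>

definition ring_morphism ::
    "('a::{ring, monoid_mult} \<Rightarrow> 'r::{ring, monoid_mult}) \<Rightarrow> bool" where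
  "ring_morphism i \<longleftrightarrow> additive i \<and> (\<forall>a b. i (a * b) = i a * i b) \<and> i 1 = 1"

text \<open>The \<open>A\<close>-bimodule structure on the \<open>A\<close>-ring \<open>R\<close>.\<close>

abbreviation (input) ring_lact :: "('a \<Rightarrow> 'r::{ring, monoid_mult}) \<Rightarrow> 'a \<Rightarrow> 'r \<Rightarrow> 'r" where
  "ring_lact i a r \<equiv> i a * r"

abbreviation (input) ring_ract :: "('a \<Rightarrow> 'r::{ring, monoid_mult}) \<Rightarrow> 'r \<Rightarrow> 'a \<Rightarrow> 'r" where
  "ring_ract i r a \<equiv> r * i a"

definition right_grouplike_character ::
    "('a::{ring, monoid_mult} \<Rightarrow> 'r::{ring, monoid_mult}) \<Rightarrow> ('r \<Rightarrow> 'a) \<Rightarrow> bool" where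
  "right_grouplike_character i \<chi> \<longleftrightarrow>
     right_linear (ring_ract i) (*) \<chi> \<and>
     (\<forall>r s. \<chi> (i (\<chi> r) * s) = \<chi> (r * s)) \<and> \<chi> 1 = 1"

definition character_act ::
    "('a::{ring, monoid_mult} \<Rightarrow> 'r::{ring, monoid_mult}) \<Rightarrow> ('r \<Rightarrow> 'a) \<Rightarrow> 'a \<Rightarrow> 'r \<Rightarrow> 'a" where
  "character_act i \<chi> a r = \<chi> (i a * r)"

lemma right_module_character_act:
  assumes "ring_morphism i" "right_grouplike_character i \<chi>"
  shows "right_module (character_act i \<chi>)"
proof
  have i: "additive i" "\<And>a b. i (a * b) = i a * i b" "i 1 = 1"
    using assms(1) by (auto simp: ring_morphism_def)
  have \<chi>: "additive \<chi>" "\<And>r a. \<chi> (r * i a) = \<chi> r * a" "\<And>r s. \<chi> (i (\<chi> r) * s) = \<chi> (r * s)" "\<chi> 1 = 1"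
    using assms(2) by (auto simp: right_grouplike_character_def right_linear_def)
  fix a b r s
  show "character_act i \<chi> (a + b) r = character_act i \<chi> a r + character_act i \<chi> b r"
    by (simp add: character_act_def additive.add[OF i(1)] additive.add[OF \<chi>(1)] distrib_right)
  show "character_act i \<chi> a (r + s) = character_act i \<chi> a r + character_act i \<chi> a s"
    by (simp add: character_act_def additive.add[OF \<chi>(1)] distrib_left)
  show "character_act i \<chi> a (r * s) = character_act i \<chi> (character_act i \<chi> a r) s"
    by (simp add: character_act_def \<chi>(3) mult.assoc)
  show "character_act i \<chi> a 1 = a"
    using \<chi>(2)[of 1 a] by (simp add: character_act_def \<chi>(4))
qed


section \<open>Strict Morita contexts and Frobenius systems\<close>

text \<open>A strict Morita context \<open>(A, A, I, J, f, g)\<close>.\<close>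

definition strict_morita_context ::
    "('a::{ring, monoid_mult} \<Rightarrow> 'i::ab_group_add \<Rightarrow> 'i) \<Rightarrow> ('i \<Rightarrow> 'a \<Rightarrow> 'i) \<Rightarrow>
     ('a \<Rightarrow> 'j::ab_group_add \<Rightarrow> 'j) \<Rightarrow> ('j \<Rightarrow> 'a \<Rightarrow> 'j) \<Rightarrow>
     (('i \<times> 'j \<Rightarrow>\<^sub>0 int) set \<Rightarrow> 'a) \<Rightarrow> (('j \<times> 'i \<Rightarrow>\<^sub>0 int) set \<Rightarrow> 'a) \<Rightarrow> bool" where
  "strict_morita_context lI rI lJ rJ f g \<longleftrightarrow>
     bimodule lI rI \<and> bimodule lJ rJ \<and>
     tensor_bimodule_map lI rI lJ rJ f \<and> bij_betw f (tensor_product rI lJ) UNIV \<and>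
     tensor_bimodule_map lJ rJ lI rI g \<and> bij_betw g (tensor_product rJ lI) UNIV \<and>
     (\<forall>u v u'. lI (f (tensor rI lJ u v)) u' = rI u (g (tensor rJ lI v u'))) \<and>
     (\<forall>v u v'. lJ (g (tensor rJ lI v u)) v' = rJ v (f (tensor rI lJ u v')))"

text \<open>
  \<open>(e, \<nu>)\<close> is an \<open>I\<close>-Frobenius system for \<open>R\<close>. The tensor \<open>e = e\<^sup>1 \<otimes> u\<^sup>1 \<otimes> e\<^sup>2\<close> is given as a finite
  sum of pure tensors, that is, by a list of triples \<open>(e\<^sup>1, u\<^sup>1, e\<^sup>2)\<close>.
\<close>

definition frobenius_system ::
    "('a::{ring, monoid_mult} \<Rightarrow> 'r::{ring, monoid_mult}) \<Rightarrow>
     ('a \<Rightarrow> 'i::ab_group_add \<Rightarrow> 'i) \<Rightarrow> ('i \<Rightarrow> 'a \<Rightarrow> 'i) \<Rightarrow>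
     ('r \<times> 'i \<times> 'r) list \<Rightarrow> (('r \<times> 'i \<Rightarrow>\<^sub>0 int) set \<Rightarrow> 'a) \<Rightarrow> bool" where
  "frobenius_system i lI rI e \<nu> \<longleftrightarrow>
     tensor_bimodule_map (ring_lact i) (ring_ract i) lI rI \<nu> \<and>
     (\<forall>r. tensor3_sum (ring_ract i) lI rI (ring_lact i) (map (\<lambda>(e1, u1, e2). (r * e1, u1, e2)) e) =
          tensor3_sum (ring_ract i) lI rI (ring_lact i) (map (\<lambda>(e1, u1, e2). (e1, u1, e2 * r)) e)) \<and>
     (\<Sum>(e1, u1, e2)\<leftarrow>e. i (\<nu> (tensor (ring_ract i) lI e1 u1)) * e2) = 1 \<and>
     (\<forall>u. tensor_sum (ring_ract i) lI
            (map (\<lambda>(e1, u1, e2). (e1, rI u1 (\<nu> (tensor (ring_ract i) lI e2 u)))) e) =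
          tensor (ring_ract i) lI 1 u)"

definition frobenius_trace ::
    "('a::{ring, monoid_mult} \<Rightarrow> 'r::{ring, monoid_mult}) \<Rightarrow> ('r \<Rightarrow> 'a) \<Rightarrow>
     ('a \<Rightarrow> 'i::ab_group_add \<Rightarrow> 'i) \<Rightarrow> ('j::ab_group_add \<Rightarrow> 'a \<Rightarrow> 'j) \<Rightarrow>
     (('j \<times> 'i \<Rightarrow>\<^sub>0 int) set \<Rightarrow> 'a) \<Rightarrow> ('r \<times> 'i \<times> 'r) list \<Rightarrow> 'j \<Rightarrow> 'a" where
  "frobenius_trace i \<chi> lI rJ g e v =
     (\<Sum>(e1, u1, e2)\<leftarrow>e. \<chi> (i (g (tensor rJ lI v (lI (\<chi> e1) u1))) * e2))"

section \<open>The trace takes values in the ring of invariants\<close>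

text \<open>
  The ring \<open>B\<close> of invariants is a subring of \<open>A\<close>, so that its unit is the unit of \<open>A\<close>. Lemma
  \<open>frobenius_trace_in_invariants\<close> shows that the trace is a map \<open>J \<rightarrow> B\<close>.
\<close>

definition int_act :: "'g::ab_group_add \<Rightarrow> int \<Rightarrow> 'g" where
  "int_act x k = (\<Sum>_<nat k. x) - (\<Sum>_<nat (- k). x)"

lemma sum_const_add: "(\<Sum>_<m + n. x) = (\<Sum>_<m. x) + (\<Sum>_<n::nat. x :: 'g::ab_group_add)"
  by (induction n) (simp_all add: add.assoc)

lemma int_act_add: "int_act x (k + l) = int_act x k + int_act x l"
proof -
  let ?S = "\<lambda>n::nat. \<Sum>_<n. x"
  have "nat (k + l) + (nat (- k) + nat (- l)) = nat (- (k + l)) + (nat k + nat l)"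
    by arith
  then have "?S (nat (k + l) + (nat (- k) + nat (- l))) = ?S (nat (- (k + l)) + (nat k + nat l))"
    by (simp only:)
  then show ?thesis
    unfolding int_act_def sum_const_add by (simp add: algebra_simps)
qed

lemma right_module_int_act: "right_module (int_act :: 'g::ab_group_add \<Rightarrow> int \<Rightarrow> 'g)"
proof
  show "int_act (x + y) r = int_act x r + int_act y r" for x y :: 'g and r
    by (simp add: int_act_def sum.distrib)
  show "int_act x (r + s) = int_act x r + int_act x s" for x :: 'g and r s
    by (rule int_act_add)
  show one: "int_act x 1 = x" for x :: 'g
    by (simp add: int_act_def)
  show "int_act x (r * s) = int_act (int_act x r) s" for x :: 'g and r s
  proof (induction s rule: int_induct[where k = 0])
    case base
    show ?case by (simp add: int_act_def)
  next
    case (step1 s)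
    then show ?case by (simp add: distrib_left int_act_add one)
  next
    case (step2 s)
    have "int_act x (r * s) = int_act x (r * (s - 1)) + int_act x r"
      using int_act_add[of x "r * (s - 1)" r] by (simp add: right_diff_distrib)
    moreover have "int_act (int_act x r) s = int_act (int_act x r) (s - 1) + int_act x r"
      using int_act_add[of "int_act x r" "s - 1" 1] by (simp add: one)
    ultimately show ?case using step2 by simp
  qed
qed

definition free_extend :: "('x \<Rightarrow> 'g::ab_group_add) \<Rightarrow> ('x \<Rightarrow>\<^sub>0 int) \<Rightarrow> 'g" where
  "free_extend F = lincomb int_act F"

lemma free_extend_of: "free_extend F (frag_of x) = F x"
  by (simp add: free_extend_def right_module.lincomb_single[OF right_module_int_act])

lemma additive_free_extend: "additive (free_extend F)"
  using right_module.right_linear_lincomb[OF right_module_int_act]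
  by (auto simp: right_linear_def free_extend_def)

lemma free_extend_sum_list: "free_extend F (\<Sum>x\<leftarrow>xs. frag_of x) = (\<Sum>x\<leftarrow>xs. F x)"
  by (induction xs)
    (simp_all add: additive.zero[OF additive_free_extend] additive.add[OF additive_free_extend]
      free_extend_of)

lemma tensor3_sum_eqD:
  fixes F :: "'m::ab_group_add \<times> 'n::ab_group_add \<times> 'p::ab_group_add \<Rightarrow> 'g::ab_group_add"
  assumes eq: "tensor3_sum rM lN rN lP ts = tensor3_sum rM lN rN lP ts'"
    and F: "\<And>m m' n p. F (m + m', n, p) = F (m, n, p) + F (m', n, p)"
      "\<And>m n n' p. F (m, n + n', p) = F (m, n, p) + F (m, n', p)"
      "\<And>m n p p'. F (m, n, p + p') = F (m, n, p) + F (m, n, p')"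
      "\<And>m a n p. F (rM m a, n, p) = F (m, lN a n, p)"
      "\<And>m n a p. F (m, rN n a, p) = F (m, n, lP a p)"
  shows "(\<Sum>t\<leftarrow>ts. F t) = (\<Sum>t\<leftarrow>ts'. F t)"
proof -
  note add = additive.add[OF additive_free_extend] additive.diff[OF additive_free_extend]
    additive.zero[OF additive_free_extend]
  have kernel: "free_extend F k = 0" if "k \<in> tensor3_rel rM lN rN lP" for k
    using that by induction (simp_all add: add free_extend_of F)
  let ?x = "\<Sum>t\<leftarrow>ts. frag_of t" and ?y = "\<Sum>t\<leftarrow>ts'. frag_of t"
  have "?x \<in> tensor3_sum rM lN rN lP ts"
    by (auto simp: tensor3_sum_def coset_by_def intro!: exI[of _ 0] tensor3_rel.zero)
  then obtain k where "k \<in> tensor3_rel rM lN rN lP" "?x = ?y + k"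
    unfolding eq by (auto simp: tensor3_sum_def coset_by_def)
  then have "free_extend F ?x = free_extend F ?y"
    by (simp add: add kernel)
  then show ?thesis by (simp add: free_extend_sum_list)
qed

lemma tensor_rel_uminus: "x \<in> tensor_rel rM lN \<Longrightarrow> - x \<in> tensor_rel rM lN"
  using tensor_rel.diff[OF tensor_rel.zero] by fastforce

lemma tensor_rel_add: "x \<in> tensor_rel rM lN \<Longrightarrow> y \<in> tensor_rel rM lN \<Longrightarrow> x + y \<in> tensor_rel rM lN"
  using tensor_rel.diff[OF _ tensor_rel_uminus] by fastforce

lemma coset_by_eqI:
  assumes "x - y \<in> tensor_rel rM lN"
  shows "coset_by (tensor_rel rM lN) x = coset_by (tensor_rel rM lN) y"
proof -
  have sub: "coset_by (tensor_rel rM lN) x \<subseteq> coset_by (tensor_rel rM lN) y"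
    if d: "x - y \<in> tensor_rel rM lN" for x y
  proof
    fix z assume "z \<in> coset_by (tensor_rel rM lN) x"
    then obtain k where "k \<in> tensor_rel rM lN" "z = x + k" by (auto simp: coset_by_def)
    with d have "(x - y) + k \<in> tensor_rel rM lN" "z = y + ((x - y) + k)"
      by (auto intro: tensor_rel_add)
    then show "z \<in> coset_by (tensor_rel rM lN) y" unfolding coset_by_def by blast
  qed
  show ?thesis
    using sub[OF assms] sub[of y x] tensor_rel_uminus[OF assms] by auto
qed

lemma tensor_add_coset_by:
  "tensor_add (coset_by (tensor_rel rM lN) x) (coset_by (tensor_rel rM lN) y) =
   coset_by (tensor_rel rM lN) (x + y)"
proof (intro equalityI subsetI)
  fix z assume "z \<in> tensor_add (coset_by (tensor_rel rM lN) x) (coset_by (tensor_rel rM lN) y)"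
  then obtain k l where "k \<in> tensor_rel rM lN" "l \<in> tensor_rel rM lN" "z = (x + y) + (k + l)"
    by (auto simp: tensor_add_def coset_by_def algebra_simps)
  then show "z \<in> coset_by (tensor_rel rM lN) (x + y)"
    unfolding coset_by_def using tensor_rel_add by blast
next
  fix z assume "z \<in> coset_by (tensor_rel rM lN) (x + y)"
  then obtain k where k: "k \<in> tensor_rel rM lN" "z = (x + 0) + (y + k)"
    by (auto simp: coset_by_def algebra_simps)
  then show "z \<in> tensor_add (coset_by (tensor_rel rM lN) x) (coset_by (tensor_rel rM lN) y)"
    unfolding tensor_add_def coset_by_def using tensor_rel.zero by blast
qed

lemma tensor_add_left:
  "tensor rM lN (m + m') n = tensor_add (tensor rM lN m n) (tensor rM lN m' n)"
  unfolding tensor_def tensor_add_coset_by by (rule coset_by_eqI) (rule tensor_rel.add_left)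

lemma tensor_add_right:
  "tensor rM lN m (n + n') = tensor_add (tensor rM lN m n) (tensor rM lN m n')"
  unfolding tensor_def tensor_add_coset_by by (rule coset_by_eqI) (rule tensor_rel.add_right)

lemma tensor_balanced: "tensor rM lN (rM m a) n = tensor rM lN m (lN a n)"
  unfolding tensor_def by (rule coset_by_eqI) (rule tensor_rel.balanced)

lemma tensor_in_tensor_product: "tensor rM lN m n \<in> tensor_product rM lN"
  by (simp add: tensor_def tensor_product_def)

lemma tensor_induced_tensor:
  assumes "\<And>k. k \<in> tensor_rel rM lN \<Longrightarrow> frag_extend (frag_of \<circ> \<phi>) k \<in> tensor_rel rM lN"
  shows "tensor_induced rM lN \<phi> (tensor rM lN m n) = tensor rM lN (fst (\<phi> (m, n))) (snd (\<phi> (m, n)))"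
proof (intro equalityI subsetI)
  fix z assume "z \<in> tensor_induced rM lN \<phi> (tensor rM lN m n)"
  then obtain k l where "k \<in> tensor_rel rM lN" "l \<in> tensor_rel rM lN"
    "z = frag_of (\<phi> (m, n)) + (frag_extend (frag_of \<circ> \<phi>) k + l)"
    by (auto simp: tensor_induced_def tensor_def coset_by_def frag_extend_add algebra_simps)
  then show "z \<in> tensor rM lN (fst (\<phi> (m, n))) (snd (\<phi> (m, n)))"
    unfolding tensor_def coset_by_def using assms tensor_rel_add by fastforce
next
  fix z assume "z \<in> tensor rM lN (fst (\<phi> (m, n))) (snd (\<phi> (m, n)))"
  then obtain k where "k \<in> tensor_rel rM lN" "z = frag_extend (frag_of \<circ> \<phi>) (frag_of (m, n) + 0) + k"
    by (auto simp: tensor_def coset_by_def)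
  then show "z \<in> tensor_induced rM lN \<phi> (tensor rM lN m n)"
    unfolding tensor_induced_def tensor_def coset_by_def using tensor_rel.zero by blast
qed

lemma tensor_lact:
  assumes "bimodule lM rM"
  shows "tensor_induced rM lN (\<lambda>(m, n). (lM a m, n)) (tensor rM lN m n) = tensor rM lN (lM a m) n"
proof (subst tensor_induced_tensor)
  have l: "\<And>x y. lM a (x + y) = lM a x + lM a y" "\<And>x b. lM a (rM x b) = rM (lM a x) b"
    using assms by (auto simp: bimodule_def left_module_def)
  show "frag_extend (frag_of \<circ> (\<lambda>(m, n). (lM a m, n))) k \<in> tensor_rel rM lN"
    if "k \<in> tensor_rel rM lN" for k
    using that by induction (simp_all add: frag_extend_diff frag_extend_add l tensor_rel.intros)
qed simp

lemma tensor_ract: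
  assumes "bimodule lN rN"
  shows "tensor_induced rM lN (\<lambda>(m, n). (m, rN n b)) (tensor rM lN m n) = tensor rM lN m (rN n b)"
proof (subst tensor_induced_tensor)
  have r: "\<And>x y. rN (x + y) b = rN x b + rN y b" "\<And>x a. rN (lN a x) b = lN a (rN x b)"
    using assms by (auto simp: bimodule_def right_module_def)
  show "frag_extend (frag_of \<circ> (\<lambda>(m, n). (m, rN n b))) k \<in> tensor_rel rM lN"
    if "k \<in> tensor_rel rM lN" for k
    using that by induction (simp_all add: frag_extend_diff frag_extend_add r tensor_rel.intros)
qed simp

lemma tensor_bimodule_mapD:
  assumes f: "tensor_bimodule_map lM rM lN rN f" and M: "bimodule lM rM" and N: "bimodule lN rN"
  shows "f (tensor rM lN (m + m') n) = f (tensor rM lN m n) + f (tensor rM lN m' n)"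
    and "f (tensor rM lN m (n + n')) = f (tensor rM lN m n) + f (tensor rM lN m n')"
    and "f (tensor rM lN (lM a m) n) = a * f (tensor rM lN m n)"
    and "f (tensor rM lN m (rN n b)) = f (tensor rM lN m n) * b"
    and "f (tensor rM lN (rM m a) n) = f (tensor rM lN m (lN a n))"
proof -
  note T = tensor_in_tensor_product[of rM lN]
  show "f (tensor rM lN (m + m') n) = f (tensor rM lN m n) + f (tensor rM lN m' n)"
    and "f (tensor rM lN m (n + n')) = f (tensor rM lN m n) + f (tensor rM lN m n')"
    using f T unfolding tensor_bimodule_map_def tensor_add_left tensor_add_right by auto
  show "f (tensor rM lN (lM a m) n) = a * f (tensor rM lN m n)"
    using f T unfolding tensor_bimodule_map_def tensor_lact[OF M, symmetric] by blast
  show "f (tensor rM lN m (rN n b)) = f (tensor rM lN m n) * b"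
    using f T unfolding tensor_bimodule_map_def tensor_ract[OF N, symmetric] by blast
  show "f (tensor rM lN (rM m a) n) = f (tensor rM lN m (lN a n))"
    by (simp add: tensor_balanced)
qed

definition invariants ::
    "('a::{ring, monoid_mult} \<Rightarrow> 'r::{ring, monoid_mult}) \<Rightarrow> ('r \<Rightarrow> 'a) \<Rightarrow> 'a set" where
  "invariants i \<chi> = {b. \<forall>r. b * \<chi> r = \<chi> (i b * r)}"

lemma frobenius_trace_in_invariants:
  assumes morita: "strict_morita_context lI rI lJ rJ f g"
    and i: "ring_morphism i" and \<chi>: "right_grouplike_character i \<chi>"
    and frob: "frobenius_system i lI rI e \<nu>"
  shows "frobenius_trace i \<chi> lI rJ g e v \<in> invariants i \<chi>"
  unfolding invariants_def mem_Collect_eq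
proof
  fix r
  have I: "bimodule lI rI" and J: "bimodule lJ rJ" and g: "tensor_bimodule_map lJ rJ lI rI g"
    using morita by (auto simp: strict_morita_context_def)
  have I': "lI (a + b) u = lI a u + lI b u" "lI a (u + u') = lI a u + lI a u'"
    "lI (a * b) u = lI a (lI b u)" "lI a (rI u b) = rI (lI a u) b" for a b u u'
    using I by (auto simp: bimodule_def left_module_def)
  have i': "i (a + b) = i a + i b" "i (a * b) = i a * i b" for a b
    using i by (auto simp: ring_morphism_def additive_def)
  have \<chi>': "\<chi> (x + y) = \<chi> x + \<chi> y" "\<chi> (x * i a) = \<chi> x * a" "\<chi> (i (\<chi> x) * y) = \<chi> (x * y)" for x y a
    using \<chi> by (auto simp: right_grouplike_character_def right_linear_def additive_def)
  define F where
    "F = (\<lambda>(e1, u1, e2). \<chi> (i (g (tensor rJ lI v (lI (\<chi> e1) u1))) * e2))"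
  note g' = tensor_bimodule_mapD[OF g J I]
  have move: "(\<Sum>(e1, u1, e2)\<leftarrow>e. F (r * e1, u1, e2)) = (\<Sum>(e1, u1, e2)\<leftarrow>e. F (e1, u1, e2 * r))" for r
  proof -
    have "tensor3_sum (ring_ract i) lI rI (ring_lact i) (map (\<lambda>(e1, u1, e2). (r * e1, u1, e2)) e) =
        tensor3_sum (ring_ract i) lI rI (ring_lact i) (map (\<lambda>(e1, u1, e2). (e1, u1, e2 * r)) e)"
      using frob by (simp add: frobenius_system_def)
    from tensor3_sum_eqD[OF this, of F] show ?thesis
      by (simp add: F_def \<chi>' I' g' i' algebra_simps case_prod_unfold comp_def)
  qed
  have hom: "h (\<Sum>t\<leftarrow>e. G t) = (\<Sum>t\<leftarrow>e. h (G t))" if "additive h" for h :: "'z::ab_group_add \<Rightarrow> 'y::ab_group_add" and G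
    by (induction e) (simp_all add: additive.zero[OF that] additive.add[OF that])
  have F_char: "F (i (\<chi> r) * e1, u1, e2) = F (r * e1, u1, e2)" for e1 u1 e2
    by (simp add: F_def \<chi>')
  have "\<chi> (i (frobenius_trace i \<chi> lI rJ g e v) * r) = (\<Sum>(e1, u1, e2)\<leftarrow>e. F (e1, u1, e2 * r))"
    unfolding frobenius_trace_def
    by (subst hom[of "\<lambda>b. \<chi> (i b * r)"])
      (simp_all add: additive_def i' \<chi>' distrib_right F_def case_prod_unfold mult.assoc)
  also have "\<dots> = (\<Sum>(e1, u1, e2)\<leftarrow>e. F (e1, u1, e2 * i (\<chi> r)))"
    unfolding move[symmetric] F_char ..
  also have "\<dots> = frobenius_trace i \<chi> lI rJ g e v * \<chi> r"
    unfolding frobenius_trace_def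
    by (subst hom[of "\<lambda>b. b * \<chi> r"])
      (simp_all add: additive_def distrib_right F_def case_prod_unfold mult.assoc[symmetric] \<chi>')
  finally show "frobenius_trace i \<chi> lI rJ g e v * \<chi> r = \<chi> (i (frobenius_trace i \<chi> lI rJ g e v) * r)" ..
qed

end

theory Submission
  imports Defs
begin

text \<open>
  Since \<open>\<chi>\<close> is an epimorphism \<open>R \<rightarrow> A\<close> of right \<open>R\<close>-modules and \<open>A\<close> is generated by \<open>1\<close>,
  projectivity of \<open>A\<close> means that \<open>\<chi>\<close> splits, that is, that there is \<open>x \<in> R\<close> with \<open>\<chi>(x) = 1\<close> and
  \<open>x r = x \<chi>(r)\<close> for all \<open>r\<close>. Every \<open>v \<in> J\<close> yields an \<open>x = g(v \<otimes> \<chi>(e\<^sup>1) u\<^sup>1) e\<^sup>2\<close>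
  satisfying the latter identity, with \<open>\<chi>(x) = tr(v)\<close>. Conversely, for any such \<open>x\<close>,
  \<open>x = \<nu>(e\<^sup>1 \<otimes> u\<^sup>1) e\<^sup>2 x = \<nu>(x e\<^sup>1 \<otimes> u\<^sup>1) e\<^sup>2 = \<nu>(x \<otimes> \<chi>(e\<^sup>1) u\<^sup>1) e\<^sup>2\<close>, and the right linear form
  \<open>u \<mapsto> \<nu>(x \<otimes> u)\<close> on \<open>I\<close> equals \<open>g(v \<otimes> -)\<close> for some \<open>v \<in> J\<close>, because \<open>f\<close> is surjective.
\<close>

lemma right_projective_character_act_iff:
  assumes i: "ring_morphism i" and \<chi>: "right_grouplike_character i \<chi>"
  shows "right_projective (character_act i \<chi>) \<longleftrightarrow> (\<exists>x. \<chi> x = 1 \<and> (\<forall>r. x * r = x * i (\<chi> r)))"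
    (is "?proj \<longleftrightarrow> (\<exists>x. ?integral x)")
proof
  have i': "i (a + b) = i a + i b" "i (a * b) = i a * i b" "i 1 = 1" for a b
    using i by (auto simp: ring_morphism_def additive_def)
  have \<chi>': "\<chi> (x + y) = \<chi> x + \<chi> y" "\<chi> (x * i a) = \<chi> x * a" "\<chi> (i (\<chi> x) * y) = \<chi> (x * y)"
    "\<chi> 1 = 1" for x y a
    using \<chi> by (auto simp: right_grouplike_character_def right_linear_def additive_def)
  have \<chi>_i: "\<chi> (i a) = a" for a
    using \<chi>'(2)[of 1 a] by (simp add: \<chi>')
  note A = right_module_character_act[OF i \<chi>]
  {
    assume ?proj
    have "right_module ((*) :: 'b \<Rightarrow> 'b \<Rightarrow> 'b)"
      by unfold_locales (simp_all add: algebra_simps)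
    moreover have "right_linear (*) (character_act i \<chi>) \<chi>"
      by (simp add: right_linear_def additive_def character_act_def \<chi>')
    moreover have "surj \<chi>"
      using \<chi>_i by (rule surjI)
    moreover have "right_linear (character_act i \<chi>) (character_act i \<chi>) (\<lambda>a. a)"
      by (simp add: right_linear_def additive_def)
    \<comment> \<open>The identity of \<open>A\<close> is lifted along \<open>\<chi>\<close>. The
      domain of \<open>\<chi>\<close> is \<open>R\<close> rather than a free module, hence the
      passage through \<open>right_projective_lifting\<close>.\<close>
    ultimately obtain s where s: "right_linear (character_act i \<chi>) (*) s" "\<And>a. \<chi> (s a) = a"
      using right_projective_lifting[OF \<open>?proj\<close>, where 'm = 'b and 'n = 'a] A
      unfolding lifting_property_def by blast
    have s_act: "s (\<chi> (i a * r)) = s a * r" for a r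
      using s(1) by (simp add: right_linear_def character_act_def)
    \<comment> \<open>Both \<open>r\<close> and \<open>i (\<chi> r)\<close> send 1 to
      \<open>\<chi> r\<close> under the character action, so linearity of \<open>s\<close> gives
      \<open>s 1 * r = s 1 * i (\<chi> r)\<close>.\<close>
    have "?integral (s 1)"
      using s_act[of 1] by (simp add: s(2) i'(3) \<chi>_i flip: s_act)
    then show "\<exists>x. ?integral x" ..
  }
  assume "\<exists>x. ?integral x"
  then obtain x where x: "\<chi> x = 1" "\<And>r. x * r = x * i (\<chi> r)"
    by blast
  show ?proj
    unfolding right_projective_def lifting_property_def
  proof (intro conjI A allI impI, elim conjE)
    fix actM :: "('a \<Rightarrow>\<^sub>0 'b) \<Rightarrow> 'b \<Rightarrow> ('a \<Rightarrow>\<^sub>0 'b)" and actN :: "'a \<Rightarrow> 'b \<Rightarrow> 'a" and q h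
    assume "right_module actM" and q: "right_linear actM actN q" "surj q"
      and h: "right_linear (character_act i \<chi>) actN h"
    then interpret M: right_module actM
      by simp
    obtain m where m: "q m = h 1"
      using q(2) by (metis surjD)
    \<comment> \<open>Linearity comes from the identity for \<open>x\<close>, which absorbs the
      inner \<open>\<chi>\<close> of the character action; it lifts \<open>h\<close> because
      \<open>\<chi> (x * i a) = a\<close>.\<close>
    define h' where "h' a = actM m (x * i a)" for a
    have "right_linear (character_act i \<chi>) actM h'"
      by (simp add: right_linear_def additive_def h'_def character_act_def i' distrib_left
          M.act_add_right mult.assoc flip: M.act_mult x(2))
    moreover have "q (h' a) = h a" for a
    proof -
      have "q (h' a) = h (character_act i \<chi> 1 (x * i a))"
        using q(1) h by (simp add: right_linear_def h'_def m)
      then show ?thesis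
        by (simp add: character_act_def i' \<chi>' x(1))
    qed
    ultimately show "\<exists>h'. right_linear (character_act i \<chi>) actM h' \<and> (\<forall>a. q (h' a) = h a)"
      by blast
  qed
qed

lemma additive_sum_list: "additive h \<Longrightarrow> h (\<Sum>t\<leftarrow>ts. F t) = (\<Sum>t\<leftarrow>ts. h (F t))"
  by (induction ts) (simp_all add: additive.zero additive.add)

text \<open>The conditions on \<open>G\<close> make \<open>i (G e1 u1) * e2\<close> triadditive and
  balanced in both places, so it may be evaluated on the two equal tensors \<open>r e\<close> and
  \<open>e r\<close>.\<close>

lemma frobenius_casimir:
  fixes G :: "'r::{ring, monoid_mult} \<Rightarrow> 'i::ab_group_add \<Rightarrow> 'a::{ring, monoid_mult}"
  assumes i: "ring_morphism i" and frob: "frobenius_system i lI rI e \<nu>"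
    and G: "\<And>x y u. G (x + y) u = G x u + G y u" "\<And>x u w. G x (u + w) = G x u + G x w"
      "\<And>x a u. G (x * i a) u = G x (lI a u)" "\<And>x u a. G x (rI u a) = G x u * a"
  shows "(\<Sum>(e1, u1, e2)\<leftarrow>e. i (G (r * e1) u1) * e2) = (\<Sum>(e1, u1, e2)\<leftarrow>e. i (G e1 u1) * e2) * r"
proof -
  have i': "i (a + b) = i a + i b" "i (a * b) = i a * i b" for a b
    using i by (auto simp: ring_morphism_def additive_def)
  define F where "F = (\<lambda>(e1, u1, e2). i (G e1 u1) * e2)"
  have "tensor3_sum (ring_ract i) lI rI (ring_lact i) (map (\<lambda>(e1, u1, e2). (r * e1, u1, e2)) e) =
      tensor3_sum (ring_ract i) lI rI (ring_lact i) (map (\<lambda>(e1, u1, e2). (e1, u1, e2 * r)) e)"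
    using frob by (simp add: frobenius_system_def)
  from tensor3_sum_eqD[OF this, of F]
  have "(\<Sum>(e1, u1, e2)\<leftarrow>e. F (r * e1, u1, e2)) = (\<Sum>(e1, u1, e2)\<leftarrow>e. F (e1, u1, e2 * r))"
    by (simp add: F_def G i' algebra_simps case_prod_unfold comp_def)
  also have "\<dots> = (\<Sum>(e1, u1, e2)\<leftarrow>e. F (e1, u1, e2)) * r"
    by (subst additive_sum_list[where h = "\<lambda>y. y * r"])
      (simp_all add: additive_def distrib_right F_def case_prod_unfold mult.assoc)
  finally show ?thesis
    by (simp add: F_def)
qed

text \<open>Write 1 as the sum of \<open>f\<close> on pure tensors of \<open>u_k\<close> and
  \<open>v_k\<close>. Associativity of the context turns \<open>u\<close> into the sum of
  \<open>rI u_k (g (v_k, u))\<close>, so applying \<open>\<phi>\<close> shows that the sum of the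
  \<open>lJ (\<phi> u_k) v_k\<close> represents \<open>\<phi>\<close>.\<close>

lemma morita_representing:
  assumes morita: "strict_morita_context lI rI lJ rJ f g" and \<phi>: "right_linear rI (*) \<phi>"
  obtains v where "\<And>u. \<phi> u = g (tensor rJ lI v u)"
proof -
  have I: "bimodule lI rI" and J: "bimodule lJ rJ" and f: "tensor_bimodule_map lI rI lJ rJ f"
    and g: "tensor_bimodule_map lJ rJ lI rI g" and bij: "bij_betw f (tensor_product rI lJ) UNIV"
    and assoc: "lI (f (tensor rI lJ u v)) u' = rI u (g (tensor rJ lI v u'))" for u v u'
    using morita by (auto simp: strict_morita_context_def)
  have lI: "lI (a + b) u = lI a u + lI b u" "lI 1 u = u" for a b u
    using I by (auto simp: bimodule_def left_module_def)
  have add_\<phi>: "additive \<phi>" and \<phi>_ract: "\<phi> (rI u a) = \<phi> u * a" for u a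
    using \<phi> by (auto simp: right_linear_def)
  define c where "c = coset_by (tensor_rel rI lJ)"
  interpret f: additive "\<lambda>x. f (c x)"
    using f unfolding tensor_bimodule_map_def tensor_product_def additive_def c_def
    by (auto simp flip: tensor_add_coset_by)
  interpret \<phi>: additive \<phi>
    by (rule add_\<phi>)
  interpret lI: additive "\<lambda>a. lI a u" for u
    by unfold_locales (rule lI)
  interpret g: additive "\<lambda>v. g (tensor rJ lI v u)" for u
    by unfold_locales (rule tensor_bimodule_mapD(1)[OF g J I])
  \<comment> \<open>Replacing 1 by the value of \<open>f\<close> at an arbitrary coset permits
    induction over the free abelian group; surjectivity of \<open>f\<close> then specializes that
    value to 1.\<close>
  have "\<exists>v. \<forall>u. \<phi> (lI (f (c x)) u) = g (tensor rJ lI v u)" for x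
  proof (rule frag_induction[of x UNIV])
    show "\<exists>v. \<forall>u. \<phi> (lI (f (c 0)) u) = g (tensor rJ lI v u)"
      by (rule exI[of _ 0]) (simp add: f.zero lI.zero \<phi>.zero g.zero)
  next
    fix p :: "'b \<times> 'c"
    have "\<phi> (lI (f (c (frag_of p))) u) = g (tensor rJ lI (lJ (\<phi> (fst p)) (snd p)) u)" for u
      using assoc[of "fst p" "snd p" u]
      by (simp add: c_def tensor_def[of rI lJ] \<phi>_ract tensor_bimodule_mapD(3)[OF g J I])
    then show "\<exists>v. \<forall>u. \<phi> (lI (f (c (frag_of p))) u) = g (tensor rJ lI v u)"
      by blast
  next
    fix x y
    assume "\<exists>v. \<forall>u. \<phi> (lI (f (c x)) u) = g (tensor rJ lI v u)"
      "\<exists>v. \<forall>u. \<phi> (lI (f (c y)) u) = g (tensor rJ lI v u)"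
    then obtain v w where "\<forall>u. \<phi> (lI (f (c x)) u) = g (tensor rJ lI v u)"
      "\<forall>u. \<phi> (lI (f (c y)) u) = g (tensor rJ lI w u)"
      by blast
    then have "\<phi> (lI (f (c (x - y))) u) = g (tensor rJ lI (v - w) u)" for u
      by (simp add: f.diff lI.diff \<phi>.diff g.diff)
    then show "\<exists>v. \<forall>u. \<phi> (lI (f (c (x - y))) u) = g (tensor rJ lI v u)"
      by blast
  qed simp
  moreover obtain x where "f (c x) = 1"
    using bij_betw_imp_surj_on[OF bij] unfolding tensor_product_def c_def
    by (metis UNIV_I imageE)
  ultimately have "\<exists>v. \<forall>u. \<phi> u = g (tensor rJ lI v u)"
    by (metis lI(2))
  with that show thesis
    by blast
qed

theorem proposition3p2:
  fixes i :: "'a::{ring, monoid_mult} \<Rightarrow> 'r::{ring, monoid_mult}"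
    and \<chi> :: "'r \<Rightarrow> 'a"
    and lI :: "'a \<Rightarrow> 'i::ab_group_add \<Rightarrow> 'i" and rI :: "'i \<Rightarrow> 'a \<Rightarrow> 'i"
    and lJ :: "'a \<Rightarrow> 'j::ab_group_add \<Rightarrow> 'j" and rJ :: "'j \<Rightarrow> 'a \<Rightarrow> 'j"
    and f :: "('i \<times> 'j \<Rightarrow>\<^sub>0 int) set \<Rightarrow> 'a" and g :: "('j \<times> 'i \<Rightarrow>\<^sub>0 int) set \<Rightarrow> 'a"
    and e :: "('r \<times> 'i \<times> 'r) list" and \<nu> :: "('r \<times> 'i \<Rightarrow>\<^sub>0 int) set \<Rightarrow> 'a"
  assumes "strict_morita_context lI rI lJ rJ f g"
    and "ring_morphism i"
    and "right_grouplike_character i \<chi>"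
    and "frobenius_system i lI rI e \<nu>"
  shows "right_projective (character_act i \<chi>) \<longleftrightarrow> (\<exists>v. frobenius_trace i \<chi> lI rJ g e v = 1)"
proof -
  note morita = assms(1) and i = assms(2) and \<chi> = assms(3) and frob = assms(4)
  have I: "bimodule lI rI" and J: "bimodule lJ rJ" and g: "tensor_bimodule_map lJ rJ lI rI g"
    using morita by (auto simp: strict_morita_context_def)
  have I': "lI (a + b) u = lI a u + lI b u" "lI a (u + u') = lI a u + lI a u'"
    "lI (a * b) u = lI a (lI b u)" "lI a (rI u b) = rI (lI a u) b" for a b u u'
    using I by (auto simp: bimodule_def left_module_def)
  have i': "i (a + b) = i a + i b" "i (a * b) = i a * i b" "i 1 = 1" for a b
    using i by (auto simp: ring_morphism_def additive_def)
  have add_\<chi>: "additive \<chi>"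
    and \<chi>': "\<chi> (x + y) = \<chi> x + \<chi> y" "\<chi> (x * i a) = \<chi> x * a" "\<chi> (i (\<chi> x) * y) = \<chi> (x * y)" for x y a
    using \<chi> by (auto simp: right_grouplike_character_def right_linear_def additive_def)
  have R: "bimodule (ring_lact i) (ring_ract i)"
    by (simp add: bimodule_def left_module_def right_module_def i' algebra_simps)
  have \<nu>: "tensor_bimodule_map (ring_lact i) (ring_ract i) lI rI \<nu>"
    and \<nu>_one: "(\<Sum>(e1, u1, e2)\<leftarrow>e. i (\<nu> (tensor (ring_ract i) lI e1 u1)) * e2) = 1"
    using frob by (simp_all add: frobenius_system_def)
  note g' = tensor_bimodule_mapD[OF g J I] and \<nu>' = tensor_bimodule_mapD[OF \<nu> R I]
  define t where "t v = (\<Sum>(e1, u1, e2)\<leftarrow>e. i (g (tensor rJ lI v (lI (\<chi> e1) u1))) * e2)" for v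
  have tr: "\<chi> (t v) = frobenius_trace i \<chi> lI rJ g e v" for v
    by (simp add: t_def frobenius_trace_def additive_sum_list[OF add_\<chi>] case_prod_unfold)
  have t_mult: "(\<Sum>(e1, u1, e2)\<leftarrow>e. i (g (tensor rJ lI v (lI (\<chi> (r * e1)) u1))) * e2) = t v * r" for v r
    unfolding t_def
    by (rule frobenius_casimir[OF i frob, where G = "\<lambda>x u. g (tensor rJ lI v (lI (\<chi> x) u))"])
      (simp_all add: g' I' \<chi>')
  \<comment> \<open>By \<open>t_mult\<close>, \<open>t v * r\<close> depends on \<open>r\<close>
    only through \<open>\<chi> (r * e1)\<close>, which is unchanged when \<open>r\<close> becomes
    \<open>i (\<chi> r)\<close>.\<close>
  have t_integral: "t v * r = t v * i (\<chi> r)" for v r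
    by (simp add: \<chi>'(3) flip: t_mult)
  have t_surj: "\<exists>v. x = t v" if x: "\<And>r. x * r = x * i (\<chi> r)" for x
  proof -
    have "right_linear rI (*) (\<lambda>u. \<nu> (tensor (ring_ract i) lI x u))"
      by (simp add: right_linear_def additive_def \<nu>')
    then obtain v where v: "\<And>u. \<nu> (tensor (ring_ract i) lI x u) = g (tensor rJ lI v u)"
      using morita_representing[OF morita] by blast
    have "x = (\<Sum>(e1, u1, e2)\<leftarrow>e. i (\<nu> (tensor (ring_ract i) lI e1 u1)) * e2) * x"
      by (simp add: \<nu>_one)
    also have "\<dots> = (\<Sum>(e1, u1, e2)\<leftarrow>e. i (\<nu> (tensor (ring_ract i) lI (x * e1) u1)) * e2)"
      by (rule frobenius_casimir[OF i frob, symmetric]) (simp_all add: \<nu>')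
    also have "\<dots> = t v"
      \<comment> \<open>The identity for \<open>x\<close> turns \<open>x * e1\<close> into
        \<open>x * i (\<chi> e1)\<close>, and balancedness moves \<open>\<chi> e1\<close> onto
        \<open>u1\<close>.\<close>
      unfolding t_def by (subst x) (simp add: \<nu>'(5) v)
    finally show ?thesis ..
  qed
  show ?thesis
    unfolding right_projective_character_act_iff[OF i \<chi>] tr[symmetric]
    using t_integral t_surj by metis
qed

end
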